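(* For every normalized goods instance with two agents and additive valuations, the algorithm Greedy-Balance for goods (described in the context) computes, in polynomial time, an allocation that is both EF1 and EQ1.
   Context: An instance consists of agents $N=\{1,2\}$, a finite set $M$ of indivisible items, and for each agent $i$ an additive valuation $v_i:2^M\to\mathbb{R}$, i.e. $v_i(\emptyset)=0$ and $v_i(S)=\sum_{o\in S}v_i(o)$. It is a goods instance if $v_i(o)\ge0$ for all $i,o$. It is normalized if $v_1(M)=v_2(M)$. An allocation $A=(A_1,A_2)$ consists of two disjoint, possibly empty bundles with union $M$. For goods: $A$ is EF1 if for all $i,j\in N$ with $A_j\neq\emptyset$ there is $g\in A_j$ with $v_i(A_i)\ge v_i(A_j\setminus\{g\})$. $A$ is EQ1 if for all $i,j\in N$ with $A_j\neq\emptyset$ there is $g\in A_j$ with $v_i(A_i)\ge v_j(A_j\setminus\{g\})$. Algorithm Greedy-Balance for goods: initialize $A_1=A_2=\emptyset$, $U_1=U_2=0$, $R=M$. While $R\neq\emptyset$: if $U_1\le U_2$, choose $g\in\arg\max_{h\in R}\{v_1(h)-v_2(h)\}$, add $g$ to $A_1$ and add $v_1(g)$ to $U_1$; otherwise choose $g\in\arg\max_{h\in R}\{v_2(h)-v_1(h)\}$, add $g$ to $A_2$ and add $v_2(g)$ to $U_2$; then remove $g$ from $R$. Return $(A_1,A_2)$. Ties in the arg max are broken arbitrarily. *)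

theory Defs
  imports
    Complex_Main
    "HOL-Computational_Algebra.Polynomial"
    "HOL-Library.Log_Nat"
    "HOL-Library.Monad_Syntax"
begin

datatype agent = Ag1 | Ag2

type_synonym 'a profile = "agent \<Rightarrow> 'a set \<Rightarrow> real"
type_synonym 'a alloc = "agent \<Rightarrow> 'a set"

definition additive_valuation :: "'a set \<Rightarrow> ('a set \<Rightarrow> real) \<Rightarrow> bool" where
  "additive_valuation M f \<longleftrightarrow> f {} = 0 \<and> (\<forall>S\<subseteq>M. f S = (\<Sum>x\<in>S. f {x}))"

definition goods_instance :: "'a set \<Rightarrow> 'a profile \<Rightarrow> bool" where
  "goods_instance M v \<longleftrightarrow>
     finite M \<and> (\<forall>i. additive_valuation M (v i)) \<and> (\<forall>i. \<forall>x\<in>M. v i {x} \<ge> 0)"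

definition normalized :: "'a set \<Rightarrow> 'a profile \<Rightarrow> bool" where
  "normalized M v \<longleftrightarrow> v Ag1 M = v Ag2 M"

definition allocation :: "'a set \<Rightarrow> 'a alloc \<Rightarrow> bool" where
  "allocation M A \<longleftrightarrow> A Ag1 \<inter> A Ag2 = {} \<and> A Ag1 \<union> A Ag2 = M"

definition EF1 :: "'a profile \<Rightarrow> 'a alloc \<Rightarrow> bool" where
  "EF1 v A \<longleftrightarrow> (\<forall>i j. A j \<noteq> {} \<longrightarrow> (\<exists>g\<in>A j. v i (A i) \<ge> v i (A j - {g})))"

definition EQ1 :: "'a profile \<Rightarrow> 'a alloc \<Rightarrow> bool" where
  "EQ1 v A \<longleftrightarrow> (\<forall>i j. A j \<noteq> {} \<longrightarrow> (\<exists>g\<in>A j. v i (A i) \<ge> v j (A j - {g})))"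


section \<open>Greedy-Balance\<close>

text \<open>A state \<open>(A, U, R)\<close> consists of the bundles, the accumulated utilities and the remaining
  items. One step is one iteration of the loop; it is nondeterministic because any maximiser may be
  chosen.\<close>

type_synonym 'a state = "'a alloc \<times> (agent \<Rightarrow> real) \<times> 'a set"

inductive gb_step :: "'a profile \<Rightarrow> 'a state \<Rightarrow> 'a state \<Rightarrow> bool" for v where
  agent1: "R \<noteq> {} \<Longrightarrow> U Ag1 \<le> U Ag2 \<Longrightarrow> is_arg_max (\<lambda>h. v Ag1 {h} - v Ag2 {h}) (\<lambda>h. h \<in> R) g \<Longrightarrow>
    gb_step v (A, U, R) (A(Ag1 := insert g (A Ag1)), U(Ag1 := U Ag1 + v Ag1 {g}), R - {g})"
| agent2: "R \<noteq> {} \<Longrightarrow> \<not> U Ag1 \<le> U Ag2 \<Longrightarrow> is_arg_max (\<lambda>h. v Ag2 {h} - v Ag1 {h}) (\<lambda>h. h \<in> R) g \<Longrightarrow>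
    gb_step v (A, U, R) (A(Ag2 := insert g (A Ag2)), U(Ag2 := U Ag2 + v Ag2 {g}), R - {g})"

definition gb_init :: "'a set \<Rightarrow> 'a state" where
  "gb_init M = ((\<lambda>_. {}), (\<lambda>_. 0), M)"

definition gb_terminates :: "'a profile \<Rightarrow> 'a set \<Rightarrow> bool" where
  "gb_terminates v M \<longleftrightarrow> termip (gb_step v) (gb_init M) \<and>
     (\<forall>A U R. (gb_step v)\<^sup>*\<^sup>* (gb_init M) (A, U, R) \<longrightarrow> R \<noteq> {} \<longrightarrow> (\<exists>s. gb_step v (A, U, R) s))"

definition gb_output :: "'a profile \<Rightarrow> 'a set \<Rightarrow> 'a alloc \<Rightarrow> bool" where
  "gb_output v M A \<longleftrightarrow> (\<exists>U. (gb_step v)\<^sup>*\<^sup>* (gb_init M) (A, U, {}))"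


section \<open>Greedy-Balance as a program with running time\<close>

text \<open>A timed computation is a result paired with its cost. Programs below handle numbers only by
  \<open>lookup\<close> and \<open>arith\<close>, whose costs depend on a size function \<open>sz\<close> for numbers: \<open>sz = (\<lambda>_. 0)\<close>
  counts elementary operations (the real RAM model), \<open>sz = rat_bits\<close> charges every operation for
  the binary lengths of its operands (the logarithmic cost criterion). Constant-time
  bookkeeping (loop and branch control, list cells, item identifiers) is charged by \<open>tick\<close>.\<close>

type_synonym 'b timed = "'b \<times> nat"

definition timed_return :: "'b \<Rightarrow> 'b timed" where
  "timed_return x = (x, 0)"

definition timed_bind :: "'b timed \<Rightarrow> ('b \<Rightarrow> 'c timed) \<Rightarrow> 'c timed" where
  "timed_bind m f = (fst (f (fst m)), snd m + snd (f (fst m)))"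

adhoc_overloading Monad_Syntax.bind \<rightleftharpoons> timed_bind

lemma timed_bind_cong [fundef_cong]:
  "m = m' \<Longrightarrow> (\<And>x. x = fst m' \<Longrightarrow> f x = f' x) \<Longrightarrow> timed_bind m f = timed_bind m' f'"
  by (simp add: timed_bind_def)

definition tick :: "unit timed" where
  "tick = ((), 1)"

definition lookup :: "(real \<Rightarrow> nat) \<Rightarrow> (agent \<Rightarrow> 'a \<Rightarrow> real) \<Rightarrow> agent \<Rightarrow> 'a \<Rightarrow> real timed" where
  "lookup sz w i h = (w i h, 1 + sz (w i h))"

definition arith :: "(real \<Rightarrow> nat) \<Rightarrow> (real \<Rightarrow> real \<Rightarrow> 'b) \<Rightarrow> real \<Rightarrow> real \<Rightarrow> 'b timed" where
  "arith sz f x y = (f x y, 1 + sz x + sz y)"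

definition gain :: "(real \<Rightarrow> nat) \<Rightarrow> (agent \<Rightarrow> 'a \<Rightarrow> real) \<Rightarrow> agent \<Rightarrow> agent \<Rightarrow> 'a \<Rightarrow> real timed" where
  "gain sz w i j h = do { x \<leftarrow> lookup sz w i h; y \<leftarrow> lookup sz w j h; arith sz (-) x y }"

text \<open>Linear scan for a maximiser of \<open>key\<close>: \<open>b\<close> is the best item so far, \<open>x\<close> its key, \<open>acc\<close> the
  discarded items; \<open>\<tau> b h\<close> tells whether \<open>h\<close> replaces \<open>b\<close> when their keys are equal. The scan
  returns the maximiser and the list of all other items.\<close>

fun scan :: "(real \<Rightarrow> nat) \<Rightarrow> ('a \<Rightarrow> 'a \<Rightarrow> bool) \<Rightarrow> ('a \<Rightarrow> real timed) \<Rightarrow>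
    'a \<Rightarrow> real \<Rightarrow> 'a list \<Rightarrow> 'a list \<Rightarrow> ('a \<times> 'a list) timed" where
  "scan sz \<tau> key b x acc [] = do { tick; timed_return (b, acc) }"
| "scan sz \<tau> key b x acc (h # hs) = do {
     tick;
     y \<leftarrow> key h;
     lt \<leftarrow> arith sz (<) x y;
     eq \<leftarrow> arith sz (=) x y;
     if lt \<or> eq \<and> \<tau> b h then scan sz \<tau> key h y (b # acc) hs
     else scan sz \<tau> key b x (h # acc) hs }"

definition select :: "(real \<Rightarrow> nat) \<Rightarrow> ('a \<Rightarrow> 'a \<Rightarrow> bool) \<Rightarrow> ('a \<Rightarrow> real timed) \<Rightarrow>
    'a \<Rightarrow> 'a list \<Rightarrow> ('a \<times> 'a list) timed" where
  "select sz \<tau> key r rs = do { x \<leftarrow> key r; scan sz \<tau> key r x [] rs }"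

lemma length_scan: "length (snd (fst (scan sz \<tau> key b x acc hs))) = length acc + length hs"
  by (induction hs arbitrary: b x acc) (simp_all add: timed_bind_def timed_return_def)

lemma length_select: "length (snd (fst (select sz \<tau> key r rs))) = length rs"
  by (simp add: select_def timed_bind_def length_scan)

text \<open>The tie-breaking rule \<open>\<tau>\<close> may depend on the list of remaining items, which is different in
  every iteration, so that letting \<open>\<tau>\<close> vary covers every way of breaking the ties.\<close>

function gb_loop :: "(real \<Rightarrow> nat) \<Rightarrow> ('a list \<Rightarrow> 'a \<Rightarrow> 'a \<Rightarrow> bool) \<Rightarrow> (agent \<Rightarrow> 'a \<Rightarrow> real) \<Rightarrow>
    (agent \<Rightarrow> 'a list) \<Rightarrow> (agent \<Rightarrow> real) \<Rightarrow> 'a list \<Rightarrow> (agent \<Rightarrow> 'a list) timed" where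
  "gb_loop sz \<tau> w B U [] = do { tick; timed_return B }"
| "gb_loop sz \<tau> w B U (r # rs) = do {
     tick;
     le \<leftarrow> arith sz (\<le>) (U Ag1) (U Ag2);
     let (i, j) = (if le then (Ag1, Ag2) else (Ag2, Ag1));
     (g, R') \<leftarrow> select sz (\<tau> (r # rs)) (gain sz w i j) r rs;
     x \<leftarrow> lookup sz w i g;
     u \<leftarrow> arith sz (+) (U i) x;
     tick;
     gb_loop sz \<tau> w (B(i := g # B i)) (U(i := u)) R' }"
  by pat_completeness auto
termination
  by (relation "measure (\<lambda>(sz, \<tau>, w, B, U, R). length R)")
     (auto, metis length_select snd_conv less_Suc_eq)

definition greedy_balance :: "(real \<Rightarrow> nat) \<Rightarrow> ('a list \<Rightarrow> 'a \<Rightarrow> 'a \<Rightarrow> bool) \<Rightarrow>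
    (agent \<Rightarrow> 'a \<Rightarrow> real) \<Rightarrow> 'a list \<Rightarrow> (agent \<Rightarrow> 'a list) timed" where
  "greedy_balance sz \<tau> w xs = gb_loop sz \<tau> w (\<lambda>_. []) (\<lambda>_. 0) xs"

text \<open>The program gets the items as a list and only the values of single items.\<close>

definition gb_result :: "('a list \<Rightarrow> 'a \<Rightarrow> 'a \<Rightarrow> bool) \<Rightarrow> 'a profile \<Rightarrow> 'a list \<Rightarrow> 'a alloc" where
  "gb_result \<tau> v xs = (\<lambda>i. set (fst (greedy_balance (\<lambda>_. 0) \<tau> (\<lambda>i h. v i {h}) xs) i))"

definition gb_time :: "(real \<Rightarrow> nat) \<Rightarrow> ('a list \<Rightarrow> 'a \<Rightarrow> 'a \<Rightarrow> bool) \<Rightarrow> 'a profile \<Rightarrow> 'a list \<Rightarrow> nat" where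
  "gb_time sz \<tau> v xs = snd (greedy_balance sz \<tau> (\<lambda>i h. v i {h}) xs)"

text \<open>Binary length of a rational number given as a reduced fraction with a sign bit; only
  meaningful for arguments in \<open>\<rat>\<close>.\<close>

definition rat_bits :: "real \<Rightarrow> nat" where
  "rat_bits x = (let (a, b) = quotient_of (inv real_of_rat x)
                 in 1 + floorlog 2 (nat \<bar>a\<bar>) + floorlog 2 (nat b))"

definition instance_bits :: "'a set \<Rightarrow> 'a profile \<Rightarrow> nat" where
  "instance_bits M v = (\<Sum>x\<in>M. rat_bits (v Ag1 {x}) + rat_bits (v Ag2 {x}))"

end

(* Let d_i = v_i - v_j for the two agents i and j. Every item that i holds has at least the d_i of
   every item that i does not hold, and the last item g given to i has the least d_i in A_i.
   Since the values of d_i on M add up to 0 by normalization, d_i is nonnegative on A_i - {g}, so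
   v_j (A_i - {g}) <= v_i (A_i - {g}). As g was given to i when i was not richer than j, also
   v_i (A_i - {g}) <= v_j (A_j). This is EQ1, and both inequalities together give EF1. *)
theory Submission
  imports Defs
begin

section \<open>Fairness of the nondeterministic algorithm\<close>

fun other :: "agent \<Rightarrow> agent" where
  "other Ag1 = Ag2"
| "other Ag2 = Ag1"

lemma other_neq [simp]: "other i \<noteq> i" "i \<noteq> other i"
  by (cases i; simp)+

lemma other_other [simp]: "other (other i) = i"
  by (cases i) simp_all

lemma agent_cases: "k = i \<or> k = other i"
  by (cases i; cases k) simp_all

definition turn :: "(agent \<Rightarrow> real) \<Rightarrow> agent" where
  "turn U = (if U Ag1 \<le> U Ag2 then Ag1 else Ag2)"

lemma turn_le: "U (turn U) \<le> U (other (turn U))"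
  by (simp add: turn_def)

definition diff :: "'a profile \<Rightarrow> agent \<Rightarrow> 'a \<Rightarrow> real" where
  "diff v i h = v i {h} - v (other i) {h}"

lemma diff_other: "diff v (other i) h = - diff v i h"
  by (simp add: diff_def)

text \<open>Merges the two rules into one, indexed by the agent whose turn it is, so that the
  invariant can be proved for both agents at once.\<close>

lemma gb_step_iff:
  "gb_step v (A, U, R) s \<longleftrightarrow>
     (\<exists>i g. i = turn U \<and> is_arg_max (diff v i) (\<lambda>h. h \<in> R) g \<and>
        s = (A(i := insert g (A i)), U(i := U i + v i {g}), R - {g}))"
proof
  assume "gb_step v (A, U, R) s"
  then show "\<exists>i g. i = turn U \<and> is_arg_max (diff v i) (\<lambda>h. h \<in> R) g \<and>
        s = (A(i := insert g (A i)), U(i := U i + v i {g}), R - {g})"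
    by cases (auto simp: turn_def diff_def is_arg_max_def)
next
  assume "\<exists>i g. i = turn U \<and> is_arg_max (diff v i) (\<lambda>h. h \<in> R) g \<and>
        s = (A(i := insert g (A i)), U(i := U i + v i {g}), R - {g})"
  then obtain g where g: "is_arg_max (diff v (turn U)) (\<lambda>h. h \<in> R) g"
    and s: "s = (A(turn U := insert g (A (turn U))),
      U(turn U := U (turn U) + v (turn U) {g}), R - {g})"
    by blast
  have "R \<noteq> {}"
    using g by (auto simp: is_arg_max_def)
  then show "gb_step v (A, U, R) s"
    using g gb_step.agent1[of R U v g A] gb_step.agent2[of R U v g A]
    by (cases "U Ag1 \<le> U Ag2") (auto simp: s turn_def is_arg_max_def diff_def)
qed

section \<open>Progress and termination\<close>

lemma gb_step_exists:
  assumes "finite R" "R \<noteq> {}"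
  shows "\<exists>s. gb_step v (A, U, R) s"
proof -
  \<comment> \<open>A minimiser of the negated difference is the required maximiser.\<close>
  have "\<exists>g. is_arg_max (diff v i) (\<lambda>h. h \<in> R) g" for i
    using ex_is_arg_min_if_finite[OF assms, of "\<lambda>h. - diff v i h"]
    by (simp add: is_arg_min_def is_arg_max_def)
  then show ?thesis
    unfolding gb_step_iff by blast
qed

lemma gb_steps_subset: "(gb_step v)\<^sup>*\<^sup>* (A, U, R) (A', U', R') \<Longrightarrow> R' \<subseteq> R"
proof (induction "(A', U', R')" arbitrary: A' U' R' rule: rtranclp_induct)
  case (step s)
  obtain A1 U1 R1 where s: "s = (A1, U1, R1)"
    by (cases s)
  then show ?case
    using step by (fastforce simp: gb_step_iff)
qed simp

lemma termip_gb_step: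
  assumes "finite R"
  shows "termip (gb_step v) (A, U, R)"
  using assms
proof (induction "card R" arbitrary: A U R rule: less_induct)
  case less
  show ?case
  \<comment> \<open>\<open>termip\<close> is accessibility under the converse relation, so every
    successor of the state has to be shown accessible.\<close>
  proof (rule accp.accI)
    fix s
    assume "(gb_step v)\<inverse>\<inverse> s (A, U, R)"
    then obtain A' U' g where s: "s = (A', U', R - {g})" and g: "g \<in> R"
      by (auto simp: gb_step_iff is_arg_max_def)
    have "card (R - {g}) < card R"
      using less.prems g by (rule card_Diff1_less)
    then show "termip (gb_step v) s"
      using less by (simp add: s)
  qed
qed

lemma gb_terminates_finite:
  assumes "finite M"
  shows "gb_terminates v M"
  unfolding gb_terminates_def gb_init_def
proof (intro conjI allI impI)
  show "termip (gb_step v) (\<lambda>_. {}, \<lambda>_. 0, M)"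
    using assms by (rule termip_gb_step)
next
  fix A U R
  assume run: "(gb_step v)\<^sup>*\<^sup>* (\<lambda>_. {}, \<lambda>_. 0, M) (A, U, R)" and "R \<noteq> {}"
  have "finite R"
    using gb_steps_subset[OF run] assms by (rule finite_subset)
  then show "\<exists>s. gb_step v (A, U, R) s"
    using \<open>R \<noteq> {}\<close> by (rule gb_step_exists)
qed

section \<open>The loop invariant and the fairness it implies\<close>

text \<open>In the last clause \<open>g\<close> is the item that \<open>i\<close> got last.\<close>

definition gb_inv :: "'a set \<Rightarrow> 'a profile \<Rightarrow> 'a state \<Rightarrow> bool" where
  "gb_inv M v = (\<lambda>(A, U, R).
     (\<forall>i. A i \<inter> A (other i) = {} \<and> A i \<inter> R = {} \<and> A i \<union> A (other i) \<union> R = M) \<and>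
     (\<forall>i. U i = (\<Sum>h\<in>A i. v i {h})) \<and>
     (\<forall>i. \<forall>h\<in>A i. \<forall>k\<in>R \<union> A (other i). diff v i k \<le> diff v i h) \<and>
     (\<forall>i. A i \<noteq> {} \<longrightarrow> (\<exists>g\<in>A i. (\<forall>h\<in>A i. diff v i g \<le> diff v i h) \<and>
        U i - v i {g} \<le> U (other i))))"

lemma gb_inv_step:
  assumes M: "goods_instance M v" and inv: "gb_inv M v (A, U, R)"
    and step: "gb_step v (A, U, R) s"
  shows "gb_inv M v s"
proof -
  from step obtain i g where i: "i = turn U" and g: "is_arg_max (diff v i) (\<lambda>h. h \<in> R) g"
    and s: "s = (A(i := insert g (A i)), U(i := U i + v i {g}), R - {g})"
    unfolding gb_step_iff by blast
  define j where "j = other i"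
  have ij [simp]: "other i = j" "other j = i" "i \<noteq> j" "j \<noteq> i"
    by (simp_all add: j_def)
  have all: "(\<forall>k. P k) \<longleftrightarrow> P i \<and> P j" for P
    using agent_cases[of _ i] by (metis j_def)
  have gR: "g \<in> R" and gmax: "\<And>h. h \<in> R \<Longrightarrow> diff v i h \<le> diff v i g"
    using g by (auto simp: is_arg_max_def not_less)
  have le: "U i \<le> U j"
    using turn_le[of U] by (simp add: i j_def)
  have parts: "A i \<inter> A j = {}" "A i \<inter> R = {}" "A j \<inter> R = {}" "A i \<union> A j \<union> R = M"
    and U: "U i = (\<Sum>h\<in>A i. v i {h})" "U j = (\<Sum>h\<in>A j. v j {h})"
    and sep: "\<And>h k. h \<in> A i \<Longrightarrow> k \<in> R \<union> A j \<Longrightarrow> diff v i k \<le> diff v i h"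
      "\<And>h k. h \<in> A j \<Longrightarrow> k \<in> R \<union> A i \<Longrightarrow> diff v j k \<le> diff v j h"
    and last: "A j \<noteq> {} \<Longrightarrow> \<exists>g\<in>A j. (\<forall>h\<in>A j. diff v j g \<le> diff v j h) \<and> U j - v j {g} \<le> U i"
    using inv unfolding gb_inv_def all split ij by blast+
  have fin: "finite M" and pos: "v i {g} \<ge> 0"
    using M gR parts(4) by (auto simp: goods_instance_def)
  have finA: "finite (A i)"
    using fin parts(4) by (metis finite_Un)
  have gA: "g \<notin> A i" "g \<notin> A j"
    using gR parts by auto
  \<comment> \<open>Against \<open>R\<close> this is the choice of \<open>g\<close> as a maximiser.
    Against \<open>A j\<close> it is the old separation of \<open>A j\<close> from \<open>R\<close>,
    with the signs reversed by \<open>diff_other\<close>.\<close>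
  have sepg: "diff v i k \<le> diff v i g" if "k \<in> R \<union> A j" for k
    using that gmax[of k] sep(2)[of k g] gR diff_other[of v i] by auto
  \<comment> \<open>The witness is \<open>g\<close>: the earlier items of \<open>i\<close> were
    separated from \<open>R\<close>, which contained \<open>g\<close>, and the utility bound reduces
    to \<open>le\<close>.\<close>
  have "\<exists>x\<in>insert g (A i). (\<forall>h\<in>insert g (A i). diff v i x \<le> diff v i h) \<and>
      U i + v i {g} - v i {x} \<le> U j"
    using sep(1) gR le by (intro bexI[of _ g]) auto
  \<comment> \<open>The old witness of \<open>j\<close> stays valid, since a good can only raise the
    utility of \<open>i\<close>.\<close>
  moreover have "\<exists>x\<in>A j. (\<forall>h\<in>A j. diff v j x \<le> diff v j h) \<and> U j - v j {x} \<le> U i + v i {g}"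
    if "A j \<noteq> {}"
    using last[OF that] pos by force
  moreover have "U i + v i {g} = (\<Sum>h\<in>insert g (A i). v i {h})"
    using finA gA U by simp
  moreover have "\<forall>h\<in>insert g (A i). \<forall>k\<in>(R - {g}) \<union> A j. diff v i k \<le> diff v i h"
    using sep(1) sepg by auto
  moreover have "\<forall>h\<in>A j. \<forall>k\<in>(R - {g}) \<union> insert g (A i). diff v j k \<le> diff v j h"
    using sep(2) gR by auto
  ultimately show ?thesis
    unfolding gb_inv_def all s using parts gA gR U(2) by auto
qed

lemma gb_inv_output:
  assumes "goods_instance M v" "gb_output v M A"
  obtains U where "gb_inv M v (A, U, {})"
proof -
  obtain U where "(gb_step v)\<^sup>*\<^sup>* (gb_init M) (A, U, {})"
    using assms(2) by (auto simp: gb_output_def)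
  then have "gb_inv M v (A, U, {})"
  proof (induction rule: rtranclp_induct)
    case base
    then show ?case
      by (simp add: gb_init_def gb_inv_def)
  next
    case (step s t)
    then show ?case
      using gb_inv_step[OF assms(1)] by (cases s) blast
  qed
  then show ?thesis
    by (rule that)
qed

lemma gb_output_fair:
  assumes M: "goods_instance M v" and norm: "normalized M v" and out: "gb_output v M A"
  shows "allocation M A \<and> EF1 v A \<and> EQ1 v A"
proof -
  obtain U where inv: "gb_inv M v (A, U, {})"
    using gb_inv_output[OF M out] .
  have part: "A i \<inter> A (other i) = {}" "A i \<union> A (other i) = M" for i
    using inv by (auto simp: gb_inv_def)
  have fin: "finite M" and val: "\<And>i S. S \<subseteq> M \<Longrightarrow> v i S = (\<Sum>x\<in>S. v i {x})"
    and pos: "\<And>i x. x \<in> M \<Longrightarrow> v i {x} \<ge> 0"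
    using M unfolding goods_instance_def additive_valuation_def by blast+
  have sub: "A i \<subseteq> M" for i
    using part(2) by blast
  then have finA: "finite (A i)" for i
    using fin finite_subset by blast
  have U: "U i = v i (A i)" for i
    using inv val[OF sub] by (simp add: gb_inv_def)
  have remove: "v i (A j - {g}) = v i (A j) - v i {g}" if "g \<in> A j" for i j g
    using that sub[of j] finA[of j] by (subst (1 2) val) (auto simp: sum_diff1)
  \<comment> \<open>This is where normalization enters.\<close>
  have zero: "(\<Sum>h\<in>A i. diff v i h) + (\<Sum>h\<in>A (other i). diff v i h) = 0" for i
  proof -
    have "(\<Sum>h\<in>A i. diff v i h) + (\<Sum>h\<in>A (other i). diff v i h) = (\<Sum>h\<in>M. diff v i h)"
      using part finA by (metis sum.union_disjoint)
    also have "\<dots> = v i M - v (other i) M"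
      by (simp add: diff_def sum_subtractf val[OF subset_refl])
    also have "\<dots> = 0"
      using norm by (cases i) (simp_all add: normalized_def)
    finally show ?thesis .
  qed
  \<comment> \<open>The witness is the item that \<open>j\<close> got last. The first inequality
    gives EQ1 for the other agent; chained with the second one it gives EF1.\<close>
  have key: "\<exists>g\<in>A j. v j (A j - {g}) \<le> v (other j) (A (other j)) \<and>
      v (other j) (A j - {g}) \<le> v j (A j - {g})" if ne: "A j \<noteq> {}" for j
  proof -
    have "\<exists>g\<in>A j. (\<forall>h\<in>A j. diff v j g \<le> diff v j h) \<and> U j - v j {g} \<le> U (other j)"
      using inv ne unfolding gb_inv_def split by blast
    then obtain g where g: "g \<in> A j" and min: "\<And>h. h \<in> A j \<Longrightarrow> diff v j g \<le> diff v j h"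
      and le: "U j - v j {g} \<le> U (other j)"
      by blast
    have sep: "diff v j k \<le> diff v j g" if "k \<in> A (other j)" for k
      using inv g that by (simp add: gb_inv_def)
    have "(\<Sum>h\<in>A j - {g}. diff v j h) \<ge> 0"
    \<comment> \<open>If the least difference in \<open>A j\<close> is nonnegative, all are.
      Otherwise those on the other bundle are negative too, so by \<open>zero\<close> the ones on
      \<open>A j\<close> add up to at least 0, and dropping the negative one of \<open>g\<close>
      only increases this sum.\<close>
    proof (cases "diff v j g \<ge> 0")
      case True
      then show ?thesis
        using min by (intro sum_nonneg) (meson DiffD1 order_trans)
    next
      case False
      then have "(\<Sum>h\<in>A (other j). diff v j h) \<le> 0"
        using sep by (intro sum_nonpos) (meson linear order_trans)
      then show ?thesis
        using zero[of j] False g finA by (simp add: sum_diff1)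
    qed
    moreover have "(\<Sum>h\<in>A j - {g}. diff v j h) = v j (A j - {g}) - v (other j) (A j - {g})"
      using sub[of j] by (subst (1 2) val) (auto simp: diff_def sum_subtractf)
    ultimately show ?thesis
      using g le remove[OF g, of j] by (intro bexI[of _ g]) (simp_all add: U)
  qed
  \<comment> \<open>EF1 and EQ1 also range over equal agents. This covers that case, by
    nonnegativity of the values.\<close>
  have own: "v i (A i - {g}) \<le> v i (A i)" if "g \<in> A i" for i g
    using remove[OF that, of i] pos[of g i] sub[of i] that by auto
  have "EF1 v A"
    unfolding EF1_def
  proof (intro allI impI)
    fix i j
    assume "A j \<noteq> {}"
    then show "\<exists>g\<in>A j. v i (A j - {g}) \<le> v i (A i)"
      using agent_cases[of i j] key[of j] own[of _ j] by (metis order_trans)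
  qed
  moreover have "EQ1 v A"
    unfolding EQ1_def
  proof (intro allI impI)
    fix i j
    assume "A j \<noteq> {}"
    then show "\<exists>g\<in>A j. v j (A j - {g}) \<le> v i (A i)"
      using agent_cases[of i j] key[of j] own[of _ j] by metis
  qed
  moreover have "allocation M A"
    using part[of Ag1] by (simp add: allocation_def)
  ultimately show ?thesis
    by blast
qed

section \<open>The program realizes exactly the nondeterministic runs\<close>

lemmas timed_defs = timed_bind_def timed_return_def tick_def lookup_def arith_def

lemma fst_gain [simp]: "fst (gain sz w i j h) = w i h - w j h"
  by (simp add: gain_def timed_defs)

text \<open>No item gets lost or duplicated. Sets, lengths and distinctness are all read off from
  this one equation in \<open>distinct_select\<close>.\<close>

lemma mset_scan:
  "fst (scan sz \<tau> key b x acc hs) = (g, R) \<Longrightarrow> mset (g # R) = mset (b # acc @ hs)"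
  by (induction hs arbitrary: b x acc) (auto simp: timed_defs split: if_splits)

text \<open>The second assumption is the invariant of the scan: the current best dominates
  everything discarded. It survives a replacement because the old best has at most the key of the
  new one.\<close>

lemma scan_maximal:
  assumes "fst (scan sz \<tau> key b (fst (key b)) acc hs) = (g, R)"
    and "\<And>h. h \<in> set acc \<Longrightarrow> fst (key h) \<le> fst (key b)"
    and "h \<in> set (b # acc @ hs)"
  shows "fst (key h) \<le> fst (key g)"
  using assms
proof (induction hs arbitrary: b acc)
  case Nil
  then show ?case
    by (auto simp: timed_defs)
next
  case (Cons a hs)
  show ?case
  proof (cases "fst (key b) < fst (key a) \<or> fst (key b) = fst (key a) \<and> \<tau> b a")
    case True
    with Cons.prems show ?thesis
      by (intro Cons.IH[of a "b # acc"]) (auto simp: timed_defs intro: order_trans less_imp_le)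
  next
    case False
    with Cons.prems show ?thesis
      by (intro Cons.IH[of b "a # acc"]) (auto simp: timed_defs not_less)
  qed
qed

text \<open>With this tie-breaking, \<open>g\<close> is taken as soon as the scan meets it, since
  its key is at least that of the current best. It is never given up again, since no key is larger
  and ties are decided for \<open>g\<close> alone.\<close>

lemma scan_chosen:
  assumes "fst (scan sz (\<lambda>b h. h = g) key b (fst (key b)) acc hs) = (g', R)"
    and "\<And>h. h \<in> set (b # hs) \<Longrightarrow> fst (key h) \<le> fst (key g)"
    and "g \<in> set (b # hs)" and "distinct (b # hs)"
  shows "g' = g"
  using assms
proof (induction hs arbitrary: b acc)
  case Nil
  then show ?case
    by (auto simp: timed_defs)
next
  case (Cons a hs)
  show ?case
  proof (cases "fst (key b) < fst (key a) \<or> fst (key b) = fst (key a) \<and> a = g")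
    case True
    moreover have "fst (key a) \<le> fst (key g)"
      using Cons.prems(2) by simp
    ultimately have "a = g \<or> b \<noteq> g"
      by auto
    with True Cons.prems show ?thesis
      by (intro Cons.IH[of a "b # acc"]) (auto simp: timed_defs)
  next
    case False
    moreover have "fst (key b) \<le> fst (key g)"
      using Cons.prems(2) by simp
    ultimately have "a \<noteq> g"
      by auto
    with False Cons.prems show ?thesis
      by (intro Cons.IH[of b "a # acc"]) (auto simp: timed_defs)
  qed
qed

lemma mset_select:
  "fst (select sz \<tau> key r rs) = (g, R) \<Longrightarrow> mset (g # R) = mset (r # rs)"
  using mset_scan[of sz \<tau> key r "fst (key r)" "[]" rs g R] by (simp add: select_def timed_defs)

lemma select_maximal:
  assumes "fst (select sz \<tau> key r rs) = (g, R)"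
  shows "is_arg_max (\<lambda>h. fst (key h)) (\<lambda>h. h \<in> set (r # rs)) g"
proof -
  have "g \<in> set (r # rs)"
    using mset_select[OF assms] by (metis list.set_intros(1) set_mset_mset)
  moreover have "fst (key h) \<le> fst (key g)" if "h \<in> set (r # rs)" for h
    using assms that scan_maximal[of sz \<tau> key r "[]" rs g R h]
    by (simp add: select_def timed_defs)
  ultimately show ?thesis
    by (auto simp: is_arg_max_def not_less)
qed

text \<open>Needed for completeness: every choice open to the nondeterministic algorithm is realized
  by some tie-breaking rule.\<close>

lemma select_chosen:
  assumes "is_arg_max (\<lambda>h. fst (key h)) (\<lambda>h. h \<in> set (r # rs)) g" "distinct (r # rs)"
  obtains R where "fst (select sz (\<lambda>b h. h = g) key r rs) = (g, R)"
proof -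
  obtain g' R where sel: "fst (select sz (\<lambda>b h. h = g) key r rs) = (g', R)"
    by fastforce
  have "g' = g"
  proof (rule scan_chosen)
    show "fst (scan sz (\<lambda>b h. h = g) key r (fst (key r)) [] rs) = (g', R)"
      using sel by (simp add: select_def timed_defs)
  qed (use assms in \<open>auto simp: is_arg_max_def not_less\<close>)
  then show ?thesis
    using sel that by blast
qed

lemma distinct_select:
  assumes "fst (select sz \<tau> key r rs) = (g, R)" "distinct (r # rs)"
  shows "distinct R" "g \<notin> set R" "set R = set (r # rs) - {g}" "g \<in> set (r # rs)"
    "length R = length rs"
proof -
  have eq: "mset (g # R) = mset (r # rs)"
    using mset_select[OF assms(1)] .
  have "distinct (g # R)"
    using mset_eq_imp_distinct_iff[OF eq] assms(2) by blast
  moreover have "set (g # R) = set (r # rs)"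
    using mset_eq_setD[OF eq] .
  moreover have "length (g # R) = length (r # rs)"
    using mset_eq_length[OF eq] .
  ultimately show "distinct R" "g \<notin> set R" "set R = set (r # rs) - {g}" "g \<in> set (r # rs)"
    "length R = length rs"
    by auto
qed

section \<open>Runs of the program and runs of the step relation\<close>

text \<open>The 5 collects two ticks and the unit costs of the comparison, the lookup and the
  addition. \<open>sz (w i g)\<close> is paid twice, for the lookup and as a summand.\<close>

lemma gb_loop_Cons:
  assumes "i = turn U" "fst (select sz (\<tau> (r # rs)) (gain sz w i (other i)) r rs) = (g, R)"
  shows "fst (gb_loop sz \<tau> w B U (r # rs)) =
      fst (gb_loop sz \<tau> w (B(i := g # B i)) (U(i := U i + w i g)) R)"
    and "snd (gb_loop sz \<tau> w B U (r # rs)) =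
      5 + sz (U Ag1) + sz (U Ag2) + snd (select sz (\<tau> (r # rs)) (gain sz w i (other i)) r rs) +
      sz (w i g) + sz (U i) + sz (w i g) +
      snd (gb_loop sz \<tau> w (B(i := g # B i)) (U(i := U i + w i g)) R)"
  using assms
  by (cases "U Ag1 \<le> U Ag2"; simp add: timed_defs turn_def Let_def)+

text \<open>The loop consults the tie-breaking rule only at lists of remaining items, and these
  never get longer. So a rule may be changed at longer lists without affecting the rest of a
  run.\<close>

lemma gb_loop_cong:
  "(\<And>L. length L \<le> length xs \<Longrightarrow> \<tau> L = \<tau>' L) \<Longrightarrow>
     gb_loop sz \<tau> w B U xs = gb_loop sz \<tau>' w B U xs"
proof (induction "length xs" arbitrary: B U xs rule: less_induct)
  case less
  show ?case
  proof (cases xs)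
    case Nil
    then show ?thesis
      by simp
  next
    case (Cons r rs)
    define i where "i = turn U"
    obtain g R where sel: "fst (select sz (\<tau> (r # rs)) (gain sz w i (other i)) r rs) = (g, R)"
      by fastforce
    have \<tau>: "\<tau> (r # rs) = \<tau>' (r # rs)"
      using less.prems Cons by simp
    have "length R = length rs"
      using sel length_select by (metis snd_conv)
    then have "gb_loop sz \<tau> w B' U' R = gb_loop sz \<tau>' w B' U' R" for B' U'
      using less Cons by simp
    then show ?thesis
      unfolding Cons prod_eq_iff
      using gb_loop_Cons[where \<tau> = \<tau>, OF i_def sel, of B] gb_loop_Cons[where \<tau> = \<tau>', OF i_def sel[unfolded \<tau>], of B] \<tau> by simp
  qed
qed

lemma gb_step_select:
  assumes "i = turn U" "distinct (r # rs)"
    and sel: "fst (select sz \<tau> (gain sz (\<lambda>i h. v i {h}) i (other i)) r rs) = (g, R)"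
  shows "gb_step v (\<lambda>i. set (B i), U, set (r # rs))
    (\<lambda>k. set ((B(i := g # B i)) k), U(i := U i + v i {g}), set R)"
  unfolding gb_step_iff
  using select_maximal[OF sel] distinct_select[OF sel assms(2)] assms(1)
  by (intro exI[of _ i] exI[of _ g]) (auto simp: diff_def is_arg_max_def fun_eq_iff)

lemma gb_loop_sound:
  "distinct xs \<Longrightarrow> \<exists>U'. (gb_step v)\<^sup>*\<^sup>* (\<lambda>i. set (B i), U, set xs)
     (\<lambda>i. set (fst (gb_loop sz \<tau> (\<lambda>i h. v i {h}) B U xs) i), U', {})"
proof (induction "length xs" arbitrary: B U xs rule: less_induct)
  case less
  show ?case
  proof (cases xs)
    case Nil
    then show ?thesis
      by (auto simp: timed_defs)
  next
    case (Cons r rs)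
    define i where "i = turn U"
    obtain g R where sel:
        "fst (select sz (\<tau> (r # rs)) (gain sz (\<lambda>i h. v i {h}) i (other i)) r rs) = (g, R)"
      by fastforce
    note R = distinct_select[OF sel less.prems[unfolded Cons]]
    show ?thesis
      using less.hyps[of R "B(i := g # B i)" "U(i := U i + v i {g})"] R Cons
        gb_step_select[OF i_def less.prems[unfolded Cons] sel, of B]
      unfolding Cons gb_loop_Cons(1)[where \<tau> = \<tau>, OF i_def sel]
      by (auto intro: converse_rtranclp_into_rtranclp)
  qed
qed

text \<open>The rule is built backwards along the run: the rule obtained for the remaining items is
  overridden at the current list so as to favour the item taken by the first step.\<close>

lemma gb_loop_complete:
  assumes "distinct xs" "(gb_step v)\<^sup>*\<^sup>* (\<lambda>i. set (B i), U, set xs) (A, U', {})"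
  shows "\<exists>\<tau>. A = (\<lambda>i. set (fst (gb_loop sz \<tau> (\<lambda>i h. v i {h}) B U xs) i))"
  using assms
proof (induction "length xs" arbitrary: B U xs rule: less_induct)
  case less
  show ?case
  proof (cases xs)
    case Nil
    have "\<not> gb_step v (\<lambda>i. set (B i), U, {}) s" for s
      by (simp add: gb_step_iff is_arg_max_def)
    with less.prems(2) Nil have "A = (\<lambda>i. set (B i))"
      by (auto elim: converse_rtranclpE)
    with Nil show ?thesis
      by (simp add: timed_defs)
  next
    case (Cons r rs)
    define i where "i = turn U"
    let ?w = "\<lambda>i h. v i {h}"
    \<comment> \<open>Items remain at the start but not at the end, so the run has a first
      step.\<close>
    have "(\<lambda>i. set (B i), U, set xs) \<noteq> (A, U', {})"
      using Cons by simp
    then obtain s where step: "gb_step v (\<lambda>i. set (B i), U, set xs) s"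
      and steps: "(gb_step v)\<^sup>*\<^sup>* s (A, U', {})"
      using less.prems(2) by (metis converse_rtranclpE)
    obtain g where g: "is_arg_max (diff v i) (\<lambda>h. h \<in> set (r # rs)) g"
      and s: "s = ((\<lambda>i. set (B i))(i := insert g (set (B i))), U(i := U i + v i {g}),
        set xs - {g})"
      using step unfolding gb_step_iff i_def Cons by blast
    obtain R where sel:
        "fst (select sz (\<lambda>b h. h = g) (gain sz ?w i (other i)) r rs) = (g, R)"
      using select_chosen[of "gain sz ?w i (other i)" r rs g sz] g less.prems(1) Cons
      by (auto simp: diff_def[abs_def])
    note R = distinct_select[OF sel less.prems(1)[unfolded Cons]]
    define B' where "B' = B(i := g # B i)"
    have "(\<lambda>i. set (B' i)) = (\<lambda>i. set (B i))(i := insert g (set (B i)))"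
      by (simp add: B'_def fun_eq_iff)
    then have "(gb_step v)\<^sup>*\<^sup>* (\<lambda>i. set (B' i), U(i := U i + v i {g}), set R) (A, U', {})"
      using steps R(3) Cons by (simp add: s)
    then obtain \<tau> where \<tau>:
        "A = (\<lambda>k. set (fst (gb_loop sz \<tau> ?w B' (U(i := U i + v i {g})) R) k))"
      using less.hyps[of R] R Cons by auto
    \<comment> \<open>The override concerns only \<open>r # rs\<close>, which is longer than
      \<open>R\<close>, so \<open>gb_loop_cong\<close> applies to the rest of the
      computation.\<close>
    define \<tau>' where "\<tau>' = \<tau>(r # rs := (\<lambda>b h. h = g))"
    have "gb_loop sz \<tau>' ?w B' (U(i := U i + v i {g})) R =
        gb_loop sz \<tau> ?w B' (U(i := U i + v i {g})) R"
      using R(5) by (intro gb_loop_cong) (auto simp: \<tau>'_def)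
    moreover have "fst (select sz (\<tau>' (r # rs)) (gain sz ?w i (other i)) r rs) = (g, R)"
      using sel by (simp add: \<tau>'_def)
    ultimately have "A = (\<lambda>k. set (fst (gb_loop sz \<tau>' ?w B U xs) k))"
      unfolding Cons using gb_loop_Cons(1)[OF i_def, of sz \<tau>' r rs ?w g R B] \<tau> B'_def by simp
    then show ?thesis
      by blast
  qed
qed

lemma gb_output_iff:
  assumes "set xs = M" "distinct xs"
  shows "gb_output v M A \<longleftrightarrow> (\<exists>\<tau>. A = gb_result \<tau> v xs)"
proof
  assume "gb_output v M A"
  then obtain U where "(gb_step v)\<^sup>*\<^sup>* (\<lambda>i. set [], \<lambda>_. 0, set xs) (A, U, {})"
    using assms(1) by (auto simp: gb_output_def gb_init_def)
  from gb_loop_complete[where B = "\<lambda>_. []", OF assms(2) this, of "\<lambda>_. 0"]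
  show "\<exists>\<tau>. A = gb_result \<tau> v xs"
    by (simp add: gb_result_def greedy_balance_def)
next
  assume "\<exists>\<tau>. A = gb_result \<tau> v xs"
  then show "gb_output v M A"
    using gb_loop_sound[OF assms(2), of v "\<lambda>_. []" "\<lambda>_. 0" "\<lambda>_. 0"] assms(1)
    by (auto simp: gb_output_def gb_init_def gb_result_def greedy_balance_def)
qed

section \<open>Running time\<close>

text \<open>Two lookups cost at most 1 + K each, the subtraction at most 1 + 2K.\<close>

lemma snd_gain:
  assumes "sz (w i h) \<le> K" "sz (w j h) \<le> K"
  shows "snd (gain sz w i j h) \<le> 3 + 4 * K"
  using assms by (simp add: gain_def timed_defs)

text \<open>Each item costs one tick, at most 3 + 4K for its key and 2(1 + 2K) for the two
  comparisons. The leading 1 is the final tick.\<close>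

lemma snd_scan:
  assumes "\<And>h. h \<in> set hs \<Longrightarrow> snd (key h) \<le> 3 + 4 * K \<and> sz (fst (key h)) \<le> K" "sz x \<le> K"
  shows "snd (scan sz \<tau> key b x acc hs) \<le> 1 + length hs * (6 + 8 * K)"
  using assms
proof (induction hs arbitrary: b x acc)
  case Nil
  then show ?case
    by (simp add: timed_defs)
next
  case (Cons a hs)
  let ?y = "fst (key a)"
  have a: "snd (key a) \<le> 3 + 4 * K" "sz ?y \<le> K"
    using Cons.prems by auto
  have IH: "snd (scan sz \<tau> key b' z acc' hs) \<le> 1 + length hs * (6 + 8 * K)"
    if "sz z \<le> K" for b' z acc'
    using Cons.IH[OF _ that] Cons.prems(1) by simp
  show ?case
    using a Cons.prems(2) IH[of ?y a "b # acc"] IH[of x b "a # acc"]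
    by (simp add: timed_defs)
qed

lemma snd_select:
  assumes "\<And>h. h \<in> set (r # rs) \<Longrightarrow> snd (key h) \<le> 3 + 4 * K \<and> sz (fst (key h)) \<le> K"
  shows "snd (select sz \<tau> key r rs) \<le> 4 + 4 * K + length rs * (6 + 8 * K)"
proof -
  have "snd (scan sz \<tau> key r (fst (key r)) [] rs) \<le> 1 + length rs * (6 + 8 * K)"
    using assms by (intro snd_scan) auto
  moreover have "snd (key r) \<le> 3 + 4 * K"
    using assms[of r] by simp
  ultimately show ?thesis
    by (simp add: select_def timed_defs)
qed

text \<open>K bounds every number the loop handles: item values, differences and utilities. The
  hypotheses on \<open>B\<close> and \<open>U\<close> keep each utility equal to a sum over a subset
  of \<open>M\<close>, so that \<open>sums\<close> covers it.\<close>

lemma snd_gb_loop: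
  assumes val: "\<And>i h. h \<in> M \<Longrightarrow> sz (w i h) \<le> K"
    and dif: "\<And>i j h. h \<in> M \<Longrightarrow> sz (w i h - w j h) \<le> K"
    and sums: "\<And>i S. S \<subseteq> M \<Longrightarrow> sz (\<Sum>h\<in>S. w i h) \<le> K"
    and "distinct xs" "set xs \<subseteq> M"
    and "\<And>i. set (B i) \<subseteq> M" "\<And>i. set (B i) \<inter> set xs = {}"
    and "\<And>i. U i = (\<Sum>h\<in>set (B i). w i h)"
  shows "snd (gb_loop sz \<tau> w B U xs) \<le> 1 + 9 * (1 + K) * length xs * length xs"
  using assms(4-)
proof (induction "length xs" arbitrary: B U xs rule: less_induct)
  case less
  show ?case
  proof (cases xs)
    case Nil
    then show ?thesis
      by (simp add: timed_defs)
  next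
    case (Cons r rs)
    define i where "i = turn U"
    define n where "n = length rs"
    obtain g R where sel: "fst (select sz (\<tau> (r # rs)) (gain sz w i (other i)) r rs) = (g, R)"
      by fastforce
    note R = distinct_select[OF sel less.prems(1)[unfolded Cons]]
    have gM: "g \<in> M"
      using R(4) less.prems(2) Cons by auto
    have "snd (gb_loop sz \<tau> w (B(i := g # B i)) (U(i := U i + w i g)) R) \<le>
        1 + 9 * (1 + K) * length R * length R"
    proof (rule less.hyps)
      show "length R < length xs" "distinct R" "set R \<subseteq> M"
        using R less.prems(2) Cons by auto
      show "set ((B(i := g # B i)) k) \<subseteq> M" for k
        using less.prems(3) gM by auto
      show "set ((B(i := g # B i)) k) \<inter> set R = {}" for k
        using less.prems(4)[of k] R(2,3) Cons by auto
      have "g \<notin> set (B i)"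
        using less.prems(4)[of i] R(4) Cons by auto
      then show "(U(i := U i + w i g)) k = (\<Sum>h\<in>set ((B(i := g # B i)) k). w k h)" for k
        using less.prems(5) by simp
    qed
    moreover have "sz (U k) \<le> K" for k
      using sums[OF less.prems(3)] less.prems(5) by simp
    then have "sz (U Ag1) \<le> K" "sz (U Ag2) \<le> K" "sz (U i) \<le> K"
      by blast+
    moreover have "sz (w i g) \<le> K"
      using val gM .
    moreover have "snd (select sz (\<tau> (r # rs)) (gain sz w i (other i)) r rs) \<le>
        4 + 4 * K + length rs * (6 + 8 * K)"
    proof (rule snd_select)
      fix h
      assume "h \<in> set (r # rs)"
      then have "h \<in> M"
        using less.prems(2) Cons by auto
      then show "snd (gain sz w i (other i) h) \<le> 3 + 4 * K \<and>
          sz (fst (gain sz w i (other i) h)) \<le> K"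
        using val dif snd_gain[of sz w i h K "other i"] by simp
    qed
    ultimately have "snd (gb_loop sz \<tau> w B U xs) \<le>
        5 + 5 * K + (4 + 4 * K + n * (6 + 8 * K)) + (1 + 9 * (1 + K) * n * n)"
      unfolding Cons gb_loop_Cons(2)[where \<tau> = \<tau>, OF i_def sel] n_def R(5) by simp
    \<comment> \<open>The constant part of one iteration is exactly 9(1 + K), and the mixed term
      18(1 + K)n of the expanded square absorbs the scan cost n(6 + 8K).\<close>
    also have "\<dots> \<le> 1 + 9 * (1 + K) * Suc n * Suc n"
      by (simp add: algebra_simps)
    finally show ?thesis
      by (simp add: Cons n_def)
  qed
qed

lemma gb_time_bound:
  assumes "set xs = M" "distinct xs"
    and "\<And>i h. h \<in> M \<Longrightarrow> sz (v i {h}) \<le> K"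
    and "\<And>i j h. h \<in> M \<Longrightarrow> sz (v i {h} - v j {h}) \<le> K"
    and "\<And>i S. S \<subseteq> M \<Longrightarrow> sz (\<Sum>h\<in>S. v i {h}) \<le> K"
  shows "gb_time sz \<tau> v xs \<le> 1 + 9 * (1 + K) * card M * card M"
proof -
  have "card M = length xs"
    using assms(1,2) distinct_card by blast
  then show ?thesis
    unfolding gb_time_def greedy_balance_def
    using snd_gb_loop[of M sz "\<lambda>i h. v i {h}" K xs "\<lambda>_. []" "\<lambda>_. 0" \<tau>] assms by simp
qed

section \<open>Bit lengths of sums of rationals\<close>

text \<open>\<open>rat_bits\<close> itself is not subadditive. A bound for some fraction that represents \<open>x\<close>,
  not necessarily reduced, behaves well under addition.\<close>

definition frac_le :: "nat \<Rightarrow> real \<Rightarrow> bool" where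
  "frac_le n x \<longleftrightarrow> (\<exists>a b :: int. b > 0 \<and> x = of_int a / of_int b \<and> \<bar>a\<bar> \<le> 2 ^ n \<and> b \<le> 2 ^ n)"

text \<open>Over the common denominator the numerator is a sum of two products, each at most 2^(m +
  n); the doubling is the \<open>Suc\<close>.\<close>

lemma frac_le_add:
  assumes "frac_le m x" "frac_le n y"
  shows "frac_le (Suc (m + n)) (x + y)"
proof -
  obtain a b c d :: int where b: "b > 0" "d > 0"
    and xy: "x = of_int a / of_int b" "y = of_int c / of_int d"
    and le: "\<bar>a\<bar> \<le> 2 ^ m" "b \<le> 2 ^ m" "\<bar>c\<bar> \<le> 2 ^ n" "d \<le> 2 ^ n"
    using assms unfolding frac_le_def by blast
  have "\<bar>a * d + c * b\<bar> \<le> \<bar>a\<bar> * d + \<bar>c\<bar> * b"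
    using b abs_triangle_ineq[of "a * d" "c * b"] by (simp add: abs_mult)
  also have "\<dots> \<le> 2 ^ m * 2 ^ n + 2 ^ n * 2 ^ m"
    using b le by (intro add_mono mult_mono) auto
  finally have "\<bar>a * d + c * b\<bar> \<le> 2 ^ Suc (m + n)"
    by (simp add: power_add)
  moreover have "b * d \<le> 2 ^ Suc (m + n)"
  proof -
    have "b * d \<le> 2 ^ m * 2 ^ n"
      using b le by (intro mult_mono) auto
    also have "\<dots> \<le> (2 :: int) ^ Suc (m + n)"
      by (simp add: power_add)
    finally show ?thesis .
  qed
  moreover have "x + y = of_int (a * d + c * b) / of_int (b * d)"
    using b by (simp add: xy add_frac_eq)
  ultimately show ?thesis
    unfolding frac_le_def using b by (metis mult_pos_pos)
qed

lemma frac_le_0: "frac_le 0 0"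
  unfolding frac_le_def by (intro exI[of _ "0 :: int"] exI[of _ "1 :: int"]) simp

lemma frac_le_uminus: "frac_le n x \<Longrightarrow> frac_le n (- x)"
  unfolding frac_le_def by (metis abs_minus_cancel minus_divide_left of_int_minus)

lemma frac_le_mono:
  assumes "frac_le m x" "m \<le> n"
  shows "frac_le n x"
proof -
  have "(2 :: int) ^ m \<le> 2 ^ n"
    using assms(2) by simp
  then show ?thesis
    using assms(1) unfolding frac_le_def by (fastforce intro: order_trans)
qed

lemma rat_bits_of_rat:
  "rat_bits (of_rat r) = (let (a, b) = quotient_of r
     in 1 + floorlog 2 (nat \<bar>a\<bar>) + floorlog 2 (nat b))"
  using inv_f_f[of real_of_rat r] by (simp add: rat_bits_def inj_def)

text \<open>The sign bit guarantees this.\<close>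

lemma rat_bits_pos: "rat_bits x > 0"
  by (simp add: rat_bits_def Let_def split_beta)

lemma le_power_floorlog: "n \<le> 2 ^ floorlog 2 n"
  using floorlog_bounds[of n 2] by (cases "n = 0") simp_all

lemma floorlog_le_Suc: "n \<le> 2 ^ k \<Longrightarrow> floorlog 2 n \<le> Suc k"
  by (rule floorlog_leI) (auto intro: le_less_trans)

text \<open>The subtracted 1 is the sign bit. It later pays for the \<open>Suc\<close> of
  \<open>frac_le_add\<close>.\<close>

lemma frac_le_rat_bits:
  assumes "x \<in> \<rat>"
  shows "frac_le (rat_bits x - 1) x"
proof -
  obtain r where x: "x = of_rat r"
    using assms by (auto elim: Rats_cases)
  obtain a b where ab: "quotient_of r = (a, b)"
    by fastforce
  let ?k = "floorlog 2 (nat \<bar>a\<bar>) + floorlog 2 (nat b)"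
  have b: "b > 0"
    using quotient_of_denom_pos[OF ab] .
  have "nat \<bar>a\<bar> \<le> 2 ^ ?k" "nat b \<le> 2 ^ ?k"
    using le_power_floorlog
    by (meson le_add1 le_add2 one_le_numeral order_trans power_increasing)+
  then have "\<bar>a\<bar> \<le> 2 ^ ?k" "b \<le> 2 ^ ?k"
    by (simp_all add: nat_le_iff)
  moreover have "x = of_int a / of_int b"
    using quotient_of_div[OF ab] by (simp add: x of_rat_divide)
  moreover have "rat_bits x - 1 = ?k"
    by (simp add: x rat_bits_of_rat ab)
  ultimately show ?thesis
    unfolding frac_le_def using b by auto
qed

text \<open>Reducing a fraction cancels a positive factor and so increases neither part. Each part
  then has at most n + 1 digits, and the sign bit gives 1 + 2(n + 1).\<close>

lemma rat_bits_le:
  assumes "frac_le n x"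
  shows "rat_bits x \<le> 3 + 2 * n"
proof -
  obtain a b :: int where b: "b > 0" and x: "x = of_int a / of_int b"
    and le: "\<bar>a\<bar> \<le> 2 ^ n" "b \<le> 2 ^ n"
    using assms unfolding frac_le_def by blast
  obtain c d where cd: "quotient_of (Fract a b) = (c, d)"
    by fastforce
  have "x = of_rat (Fract a b)"
    using b by (simp add: x of_rat_rat)
  then have bits: "rat_bits x = 1 + floorlog 2 (nat \<bar>c\<bar>) + floorlog 2 (nat d)"
    by (simp add: rat_bits_of_rat cd)
  have norm: "Rat.normalize (a, b) = (c, d)"
    using cd by (simp add: quotient_of_Fract)
  define e where "e = gcd a b"
  have e: "e > 0"
    using b by (simp add: e_def)
  have "c = a div e" "d = b div e"
    using norm b by (simp_all add: Rat.normalize_def e_def Let_def)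
  then have ab: "a = e * c" "b = e * d"
    by (simp_all add: e_def)
  have "d > 0"
    using e b by (simp add: ab zero_less_mult_iff)
  then have "1 * \<bar>c\<bar> \<le> e * \<bar>c\<bar>" "1 * d \<le> e * d"
    using e by (intro mult_right_mono; simp)+
  then have "\<bar>c\<bar> \<le> \<bar>a\<bar>" "d \<le> b"
    using e by (simp_all add: ab abs_mult)
  then have "nat \<bar>c\<bar> \<le> 2 ^ n" "nat d \<le> 2 ^ n"
    using le by (simp_all add: nat_le_iff)
  then show ?thesis
    unfolding bits using floorlog_le_Suc[of "nat \<bar>c\<bar>" n] floorlog_le_Suc[of "nat d" n] by simp
qed

text \<open>Each addition loses one bit, which is the sign bit saved by
  \<open>frac_le_rat_bits\<close>, so the bit lengths simply add up.\<close>

lemma frac_le_sum: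
  assumes "finite S" "\<And>x. x \<in> S \<Longrightarrow> f x \<in> \<rat>"
  shows "frac_le (\<Sum>x\<in>S. rat_bits (f x)) (\<Sum>x\<in>S. f x)"
  using assms
proof (induction S rule: finite_induct)
  case empty
  show ?case
    by (simp add: frac_le_0)
next
  case (insert x S)
  have "frac_le (Suc (rat_bits (f x) - 1 + (\<Sum>x\<in>S. rat_bits (f x)))) (f x + (\<Sum>x\<in>S. f x))"
    using insert by (intro frac_le_add frac_le_rat_bits) auto
  then show ?case
    using insert.hyps rat_bits_pos[of "f x"] by simp
qed

text \<open>All differences and partial sums satisfy \<open>frac_le\<close> with the input length L,
  so by \<open>rat_bits_le\<close> the general bound applies with K = 3 + 2L.\<close>

lemma gb_time_rat_bits:
  assumes fin: "finite M" and rat: "\<And>i x. x \<in> M \<Longrightarrow> v i {x} \<in> \<rat>"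
    and xs: "set xs = M" "distinct xs"
  shows "gb_time rat_bits \<tau> v xs \<le> 1 + 9 * (4 + 2 * instance_bits M v) * card M * card M"
    and "card M \<le> instance_bits M v"
proof -
  define L where "L = instance_bits M v"
  have item: "rat_bits (v Ag1 {x}) + rat_bits (v Ag2 {x}) \<le> L" if "x \<in> M" for x
    unfolding L_def instance_bits_def using fin that
    by (intro member_le_sum[where f = "\<lambda>x. rat_bits (v Ag1 {x}) + rat_bits (v Ag2 {x})"]) auto
  then have one: "rat_bits (v i {x}) \<le> L" if "x \<in> M" for i x
    using that by (cases i) (force dest: item)+
  have "gb_time rat_bits \<tau> v xs \<le> 1 + 9 * (1 + (3 + 2 * L)) * card M * card M"
  proof (rule gb_time_bound[OF xs])
    show "rat_bits (v i {h}) \<le> 3 + 2 * L" if "h \<in> M" for i h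
      using one[OF that, of i] by simp
  next
    fix i j h
    assume h: "h \<in> M"
    show "rat_bits (v i {h} - v j {h}) \<le> 3 + 2 * L"
    proof (cases "i = j")
      \<comment> \<open>Equal agents are separate because \<open>item\<close> bounds only the joint
        length of the values of two different agents. Here the difference is 0.\<close>
      case True
      then show ?thesis
        using rat_bits_le[OF frac_le_0] by simp
    next
      case False
      have "frac_le (Suc (rat_bits (v i {h}) - 1 + (rat_bits (v j {h}) - 1)))
          (v i {h} + - v j {h})"
        using rat h by (intro frac_le_add frac_le_uminus frac_le_rat_bits)
      moreover have "Suc (rat_bits (v i {h}) - 1 + (rat_bits (v j {h}) - 1)) \<le> L"
        using False item[OF h] rat_bits_pos[of "v i {h}"] rat_bits_pos[of "v j {h}"]
        by (cases i; cases j) auto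
      ultimately have "frac_le L (v i {h} - v j {h})"
        using frac_le_mono by simp
      then show ?thesis
        by (rule rat_bits_le)
    qed
  next
    fix i S
    assume S: "S \<subseteq> M"
    have "(\<Sum>x\<in>S. rat_bits (v i {x})) \<le> (\<Sum>x\<in>M. rat_bits (v i {x}))"
      using fin S by (intro sum_mono2) auto
    also have "\<dots> \<le> L"
      unfolding L_def instance_bits_def by (intro sum_mono) (cases i; simp)
    finally have "frac_le L (\<Sum>h\<in>S. v i {h})"
      using frac_le_sum[of S "\<lambda>x. v i {x}"] S fin rat finite_subset frac_le_mono by blast
    then show "rat_bits (\<Sum>h\<in>S. v i {h}) \<le> 3 + 2 * L"
      by (rule rat_bits_le)
  qed
  then show "gb_time rat_bits \<tau> v xs \<le> 1 + 9 * (4 + 2 * instance_bits M v) * card M * card M"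
    by (simp add: L_def)
  \<comment> \<open>Each item contributes at least one bit, so the input length also bounds the
    number of iterations.\<close>
  have "card M = (\<Sum>x\<in>M. 1)"
    by simp
  also have "\<dots> \<le> instance_bits M v"
    unfolding instance_bits_def using rat_bits_pos by (intro sum_mono) (simp add: Suc_leI trans_le_add1)
  finally show "card M \<le> instance_bits M v" .
qed

theorem theorem2:
  shows "(\<forall>(M :: 'a set) v. goods_instance M v \<longrightarrow> normalized M v \<longrightarrow>
            gb_terminates v M \<and>
            (\<forall>A. gb_output v M A \<longrightarrow> allocation M A \<and> EF1 v A \<and> EQ1 v A) \<and>
            (\<forall>xs. set xs = M \<longrightarrow> distinct xs \<longrightarrow>
               (\<forall>A. gb_output v M A \<longleftrightarrow> (\<exists>\<tau>. A = gb_result \<tau> v xs)))) \<and>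
         (\<exists>p :: nat poly. \<forall>(M :: 'a set) v xs \<tau>. goods_instance M v \<longrightarrow> normalized M v \<longrightarrow>
            set xs = M \<longrightarrow> distinct xs \<longrightarrow>
            gb_time (\<lambda>_. 0) \<tau> v xs \<le> poly p (card M)) \<and>
         (\<exists>q :: nat poly. \<forall>(M :: 'a set) v xs \<tau>. goods_instance M v \<longrightarrow> normalized M v \<longrightarrow>
            (\<forall>i. \<forall>x\<in>M. v i {x} \<in> \<rat>) \<longrightarrow> set xs = M \<longrightarrow> distinct xs \<longrightarrow>
            gb_time rat_bits \<tau> v xs \<le> poly q (instance_bits M v))"
proof (intro conjI)
  show "\<forall>(M :: 'a set) v. goods_instance M v \<longrightarrow> normalized M v \<longrightarrow>
            gb_terminates v M \<and>
            (\<forall>A. gb_output v M A \<longrightarrow> allocation M A \<and> EF1 v A \<and> EQ1 v A) \<and>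
            (\<forall>xs. set xs = M \<longrightarrow> distinct xs \<longrightarrow>
               (\<forall>A. gb_output v M A \<longleftrightarrow> (\<exists>\<tau>. A = gb_result \<tau> v xs)))"
    using gb_terminates_finite gb_output_fair gb_output_iff
    by (metis goods_instance_def)
next
  \<comment> \<open>Numbers have size 0 here, so K = 0 and the bound is 1 + 9n^2.\<close>
  have "gb_time (\<lambda>_. 0) \<tau> v xs \<le> poly [:1, 0, 9:] (card M)"
    if "set xs = M" "distinct xs" for M :: "'a set" and v xs \<tau>
    using gb_time_bound[OF that, of "\<lambda>_. 0" v 0 \<tau>] by (simp add: algebra_simps)
  then show "\<exists>p :: nat poly. \<forall>(M :: 'a set) v xs \<tau>. goods_instance M v \<longrightarrow> normalized M v \<longrightarrow>
            set xs = M \<longrightarrow> distinct xs \<longrightarrow> gb_time (\<lambda>_. 0) \<tau> v xs \<le> poly p (card M)"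
    by blast
next
  \<comment> \<open>The coefficients come from expanding 1 + 9(4 + 2L)L^2.\<close>
  have "gb_time rat_bits \<tau> v xs \<le> poly [:1, 0, 36, 18:] (instance_bits M v)"
    if "finite M" "\<forall>i. \<forall>x\<in>M. v i {x} \<in> \<rat>" "set xs = M" "distinct xs"
    for M :: "'a set" and v xs \<tau>
  proof -
    define L where "L = instance_bits M v"
    have "gb_time rat_bits \<tau> v xs \<le> 1 + 9 * (4 + 2 * L) * card M * card M" "card M \<le> L"
      using gb_time_rat_bits[of M v xs] that by (simp_all add: L_def)
    moreover from this(2) have "9 * (4 + 2 * L) * card M * card M \<le> 9 * (4 + 2 * L) * L * L"
      by (intro mult_mono) auto
    ultimately have "gb_time rat_bits \<tau> v xs \<le> 1 + 9 * (4 + 2 * L) * L * L"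
      by linarith
    also have "\<dots> = poly [:1, 0, 36, 18:] L"
      by (simp add: algebra_simps)
    finally show ?thesis
      by (simp add: L_def)
  qed
  then show "\<exists>q :: nat poly. \<forall>(M :: 'a set) v xs \<tau>. goods_instance M v \<longrightarrow> normalized M v \<longrightarrow>
            (\<forall>i. \<forall>x\<in>M. v i {x} \<in> \<rat>) \<longrightarrow> set xs = M \<longrightarrow> distinct xs \<longrightarrow>
            gb_time rat_bits \<tau> v xs \<le> poly q (instance_bits M v)"
    by (metis goods_instance_def)
qed

end
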